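(* Let $m,n\ge 1$ be integers and let $M=2^b$ for an integer $b$, with $M\ge 4$. Let $\mathbf H\in\mathbb C^{m\times n}$, $v\in\mathbb C^m$, let $x^*\in\mathbb C^n$ have all entries in the $M$-PSK symbol set $\mathcal S_M$, and put $r=\mathbf Hx^*+v$. Define $\mathbf Q=\mathbf H^\dagger\mathbf H$, and $z\in\mathbb C^n$ by $z_i=(x_i^* )^{-1}(\mathbf H^\dagger v)_i$ for $i=1,\dots,n$. Then the relaxation (ESDR-X) built from $\mathbf H$ and $r$ is tight if and only if $$\mathbf Q+\mathrm{Diag}\big(\mathrm{Re}(z)\big)-\cot\left(\frac{\pi}{M}\right)\mathrm{Diag}\big(|\mathrm{Im}(z)|\big)\succeq 0 .$$
   Context: Notation: $(\cdot)^\dagger$ is the conjugate transpose; $\mathrm{Re},\mathrm{Im},|\cdot|$ act entrywise on vectors; $\mathrm{Diag}(u)$ is the diagonal matrix with diagonal $u$; $\mathbf A\succeq\mathbf B$ means that $\mathbf A-\mathbf B$ is (Hermitian) positive semidefinite; $\langle \mathbf A,\mathbf B\rangle=\mathrm{Re}(\mathrm{Tr}(\mathbf A^\dagger\mathbf B))$; $\mathbf i$ is the imaginary unit. $M$-PSK symbols: $s_j=e^{\mathbf i\theta_j}$ with $\theta_j=2(j-1)\pi/M$, $j=1,\dots,M$, and $\mathcal S_M=\{s_1,\dots,s_M\}$. Put $\mathbf Q=\mathbf H^\dagger\mathbf H$ and $c=-\mathbf H^\dagger r$. (ESDR-X) is the semidefinite program in the variables $t=(t_{i,j})\in\mathbb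 R^{Mn}$, $x\in\mathbb C^n$, $\mathbf X\in\mathbb C^{n\times n}$ (Hermitian): minimize $\langle\mathbf Q,\mathbf X\rangle+2\,\mathrm{Re}(c^\dagger x)$ subject to $X_{i,i}=1$ for $i=1,\dots,n$; $x_i=\sum_{j=1}^M t_{i,j}s_j$ and $\sum_{j=1}^M t_{i,j}=1$ for $i=1,\dots,n$; $t_{i,j}\ge 0$ for all $i,j$; $\mathbf X\succeq xx^\dagger$. (ESDR-X) is called tight if $(x,\mathbf X)=(x^*,x^*(x^* )^\dagger)$ (together with the corresponding $t$) is an optimal solution of it; uniqueness of the optimal solution is not required. *)

theory Defs
  imports "HOL-Analysis.Analysis"
begin

definition ctranspose :: "complex^'n^'m \<Rightarrow> complex^'m^'n" where
  "ctranspose A = (\<chi> i j. cnj (A $ j $ i))"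

definition hermitian :: "complex^'n^'n \<Rightarrow> bool" where
  "hermitian A \<longleftrightarrow> ctranspose A = A"

text \<open>The complex product $u^\dagger w$, conjugate-linear in the first argument; the library's
  \<open>\<bullet>\<close> on complex vectors is its real part.\<close>

definition cdot :: "complex^'n \<Rightarrow> complex^'n \<Rightarrow> complex" where
  "cdot u w = (\<Sum>i\<in>UNIV. cnj (u $ i) * w $ i)"

text \<open>For Hermitian \<open>A\<close> the number $u^\dagger A u$ is real, so taking its real part loses nothing.\<close>

definition psd :: "complex^'n^'n \<Rightarrow> bool" where
  "psd A \<longleftrightarrow> hermitian A \<and> (\<forall>u. 0 \<le> Re (cdot u (A *v u)))"

definition loewner_ge :: "complex^'n^'n \<Rightarrow> complex^'n^'n \<Rightarrow> bool" (infix "\<succeq>" 50) where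
  "A \<succeq> B \<longleftrightarrow> psd (A - B)"

definition mat_inner :: "complex^'n^'m \<Rightarrow> complex^'n^'m \<Rightarrow> real" where
  "mat_inner A B = Re (trace (ctranspose A ** B))"

text \<open>The rank-one matrix $x x^\dagger$.\<close>

definition outer_self :: "complex^'n \<Rightarrow> complex^'n^'n" where
  "outer_self x = (\<chi> i j. x $ i * cnj (x $ j))"

definition Diag :: "real^'n \<Rightarrow> complex^'n^'n" where
  "Diag u = (\<chi> i j. if i = j then complex_of_real (u $ i) else 0)"

definition vec_Re :: "complex^'n \<Rightarrow> real^'n" where
  "vec_Re z = (\<chi> i. Re (z $ i))"

definition vec_Im :: "complex^'n \<Rightarrow> real^'n" where
  "vec_Im z = (\<chi> i. Im (z $ i))"

definition vec_abs :: "real^'n \<Rightarrow> real^'n" where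
  "vec_abs u = (\<chi> i. \<bar>u $ i\<bar>)"

text \<open>Symbols are indexed by \<open>j = 1, \<dots>, M\<close>.\<close>

definition psk_symbol :: "nat \<Rightarrow> nat \<Rightarrow> complex" where
  "psk_symbol M j = cis (2 * (real j - 1) * pi / real M)"

definition psk_set :: "nat \<Rightarrow> complex set" where
  "psk_set M = psk_symbol M ` {1..M}"

text \<open>The variable $t \in \mathbb{R}^{Mn}$ is encoded as a function of \<open>i\<close> and \<open>j\<close>; its values
  at \<open>j \<notin> {1..M}\<close> are irrelevant.\<close>

definition esdr_feasible ::
    "nat \<Rightarrow> ('n \<Rightarrow> nat \<Rightarrow> real) \<Rightarrow> complex^'n \<Rightarrow> complex^'n^'n \<Rightarrow> bool" where
  "esdr_feasible M t x X \<longleftrightarrow>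
     hermitian X \<and>
     (\<forall>i. X $ i $ i = 1) \<and>
     (\<forall>i. x $ i = (\<Sum>j=1..M. complex_of_real (t i j) * psk_symbol M j)) \<and>
     (\<forall>i. (\<Sum>j=1..M. t i j) = 1) \<and>
     (\<forall>i. \<forall>j\<in>{1..M}. 0 \<le> t i j) \<and>
     X \<succeq> outer_self x"

definition esdr_objective ::
    "complex^'n^'m \<Rightarrow> complex^'m \<Rightarrow> complex^'n \<Rightarrow> complex^'n^'n \<Rightarrow> real" where
  "esdr_objective H r x X =
     (let Q = ctranspose H ** H; c = - (ctranspose H *v r)
      in mat_inner Q X + 2 * Re (cdot c x))"

definition esdr_optimal ::
    "nat \<Rightarrow> complex^'n^'m \<Rightarrow> complex^'m \<Rightarrow>
     ('n \<Rightarrow> nat \<Rightarrow> real) \<Rightarrow> complex^'n \<Rightarrow> complex^'n^'n \<Rightarrow> bool" where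
  "esdr_optimal M H r t x X \<longleftrightarrow>
     esdr_feasible M t x X \<and>
     (\<forall>t' x' X'. esdr_feasible M t' x' X' \<longrightarrow>
        esdr_objective H r x X \<le> esdr_objective H r x' X')"

definition esdr_tight ::
    "nat \<Rightarrow> complex^'n^'m \<Rightarrow> complex^'m \<Rightarrow> complex^'n \<Rightarrow> bool" where
  "esdr_tight M H r xs \<longleftrightarrow> (\<exists>t. esdr_optimal M H r t xs (outer_self xs))"

end

theory Submission
  imports Defs
begin

text \<open>Write \<open>x = xs + d\<close> and let \<open>V = (X - x x\<^sup>\<dagger>) + d d\<^sup>\<dagger>\<close>, so that \<open>V\<close> is positive semidefinite.
  After rotating every coordinate by the conjugate of \<open>xs\<^sub>i\<close>, the constraint \<open>X\<^sub>i\<^sub>i = 1\<close>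
  becomes \<open>V\<^sub>i\<^sub>i = 2 (1 - Re y\<^sub>i)\<close>, where \<open>y\<^sub>i\<close> lies in the regular polygon with vertex \<open>1\<close>, and the
  objective exceeds its value at \<open>xs\<close> by
  \<open>\<langle>Q + Diag (Re z), V\<rangle> - 2 \<Sum>\<^sub>i Im z\<^sub>i Im y\<^sub>i\<close>. The polygon is contained in the cone
  \<open>\<bar>Im y\<^sub>i\<bar> \<le> cot (\<pi>/M) (1 - Re y\<^sub>i)\<close> at its vertex \<open>1\<close>, so the excess is at least
  \<open>\<langle>A, V\<rangle>\<close> with \<open>A\<close> the matrix of the criterion. Conversely, a vector \<open>u\<close> with
  \<open>u\<^sup>\<dagger> A u < 0\<close> yields a positive definite \<open>P\<close> near \<open>u u\<^sup>\<dagger>\<close> with \<open>\<langle>A, P\<rangle> < 0\<close>, and moving along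
  the polygon edges realises \<open>V = \<epsilon> P\<close> with equality in the cone bound.\<close>

section \<open>Hermitian forms and rank-one matrices\<close>

text \<open>The cross terms in expanding \<open>outer_self (xs + d)\<close> have this two-vector
  form.\<close>

definition outer :: "complex^'n \<Rightarrow> complex^'m \<Rightarrow> complex^'m^'n" where
  "outer x y = (\<chi> i j. x $ i * cnj (y $ j))"

lemma outer_self_eq_outer: "outer_self x = outer x x"
  by (simp add: outer_self_def outer_def)

lemma inner_complex_eq_Re: "(a::complex) \<bullet> b = Re (cnj a * b)"
  by (simp add: inner_complex_def)

lemma Re_cdot_eq_inner: "Re (cdot u w) = u \<bullet> w"
  by (simp add: cdot_def inner_vec_def inner_complex_def)

lemma mat_inner_eq_inner: "mat_inner A B = A \<bullet> B"
  unfolding mat_inner_def trace_def ctranspose_def matrix_matrix_mult_def inner_vec_def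
  by (simp add: inner_complex_def) (rule sum.swap)

text \<open>Turns a quadratic form in a vector into a linear functional of a rank-one matrix, so
  that form values and matrix pairings can be exchanged.\<close>

lemma inner_outer: "A \<bullet> outer x y = x \<bullet> (A *v y)"
  by (simp add: inner_vec_def outer_def matrix_vector_mult_def inner_complex_eq_Re
      sum_distrib_left sum_distrib_right algebra_simps)

lemma inner_scaleR_matrix: "x \<bullet> ((c *\<^sub>R A) *v y) = c * (x \<bullet> (A *v y))" for A :: "complex^'n^'m"
  by (simp flip: inner_outer)

lemma inner_ctranspose: "x \<bullet> (A *v y) = (ctranspose A *v x) \<bullet> y"
proof -
  have "x \<bullet> (A *v y) = (\<Sum>i\<in>UNIV. \<Sum>j\<in>UNIV. Re (cnj (x$i) * (A$i$j * y$j)))"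
    by (simp add: inner_vec_def matrix_vector_mult_def inner_complex_eq_Re sum_distrib_left
        del: times_complex.sel)
  also have "\<dots> = (\<Sum>j\<in>UNIV. \<Sum>i\<in>UNIV. Re (cnj (x$i) * (A$i$j * y$j)))"
    by (rule sum.swap)
  also have "\<dots> = (ctranspose A *v x) \<bullet> y"
    by (simp add: inner_vec_def matrix_vector_mult_def inner_complex_eq_Re ctranspose_def
        sum_distrib_left sum_distrib_right mult_ac del: times_complex.sel)
  finally show ?thesis .
qed

lemma hermitian_nth: "hermitian A \<Longrightarrow> cnj (A $ j $ i) = A $ i $ j"
  unfolding hermitian_def ctranspose_def by (metis vec_lambda_beta)

lemma hermitianI: "(\<And>i j. cnj (A $ j $ i) = A $ i $ j) \<Longrightarrow> hermitian A"
  by (simp add: hermitian_def ctranspose_def vec_eq_iff)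

lemma hermitian_inner: "hermitian A \<Longrightarrow> x \<bullet> (A *v y) = (A *v x) \<bullet> y"
  using inner_ctranspose[of x A y] by (simp add: hermitian_def)

lemma hermitian_add: "hermitian A \<Longrightarrow> hermitian B \<Longrightarrow> hermitian (A + B)"
  by (intro hermitianI) (simp add: hermitian_nth)

lemma hermitian_diff: "hermitian A \<Longrightarrow> hermitian B \<Longrightarrow> hermitian (A - B)"
  by (intro hermitianI) (simp add: hermitian_nth)

lemma hermitian_scaleR: "hermitian A \<Longrightarrow> hermitian (c *\<^sub>R A)"
  by (intro hermitianI) (simp add: hermitian_nth)

lemma hermitian_outer: "hermitian (outer x x)"
  by (intro hermitianI) (simp add: outer_def)

lemma hermitian_outer_cross: "hermitian (outer x y + outer y x)"
  by (intro hermitianI) (simp add: outer_def)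

lemma hermitian_mat: "hermitian (mat 1)"
  by (intro hermitianI) (simp add: mat_def)

lemma hermitian_Diag: "hermitian (Diag w)"
  by (intro hermitianI) (simp add: Diag_def)

lemma hermitian_gram: "hermitian (ctranspose H ** H)"
  by (intro hermitianI) (simp add: ctranspose_def matrix_matrix_mult_def mult.commute)

lemma psd_iff: "psd A \<longleftrightarrow> hermitian A \<and> (\<forall>u. 0 \<le> u \<bullet> (A *v u))"
  by (simp add: psd_def Re_cdot_eq_inner)

lemma psdD: "psd A \<Longrightarrow> 0 \<le> u \<bullet> (A *v u)"
  by (simp add: psd_iff)

lemma quadratic_outer: "u \<bullet> (outer x x *v u) = (cmod (cdot x u))\<^sup>2"
proof -
  have "outer x x *v u = (\<chi> i. x $ i * cdot x u)"
    by (simp add: vec_eq_iff matrix_vector_mult_def outer_def cdot_def sum_distrib_left mult.assoc)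
  then have "cdot u (outer x x *v u) = cdot u x * cdot x u"
    by (simp add: cdot_def sum_distrib_right mult.assoc)
  also have "cdot u x = cnj (cdot x u)"
    by (simp add: cdot_def mult.commute)
  finally have "u \<bullet> (outer x x *v u) = Re (cnj (cdot x u) * cdot x u)"
    by (simp add: Re_cdot_eq_inner[symmetric])
  then show ?thesis
    unfolding cmod_power2 by (simp add: power2_eq_square)
qed

lemma psd_outer: "psd (outer x x)"
  by (simp add: psd_iff hermitian_outer quadratic_outer)

lemma psd_add: "psd A \<Longrightarrow> psd B \<Longrightarrow> psd (A + B)"
  by (simp add: psd_iff hermitian_add matrix_vector_mult_add_rdistrib inner_add_right)

lemma cmod_cdot_le: "cmod (cdot x u) \<le> norm x * norm u"
proof -
  have "cmod (cdot x u) \<le> (\<Sum>i\<in>UNIV. cmod (x $ i) * cmod (u $ i))"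
    unfolding cdot_def by (rule order_trans[OF norm_sum]) (simp add: norm_mult)
  also have "\<dots> \<le> norm x * norm u"
    unfolding norm_vec_def using L2_set_mult_ineq[of "\<lambda>i. cmod (x $ i)" "\<lambda>i. cmod (u $ i)" UNIV]
    by simp
  finally show ?thesis .
qed

section \<open>Schur complements and pairings of semidefinite matrices\<close>

lemma matrix_vector_scale_axis:
  fixes A :: "complex^'n^'m"
  shows "A *v (\<chi> i. if i = k then a else 0) = (\<chi> i. A $ i $ k * a)"
  by (simp add: vec_eq_iff matrix_vector_mult_def if_distrib[of "\<lambda>y. _ * y"] cong: if_cong)

lemma psd_diag_nonneg:
  assumes "psd A" shows "0 \<le> Re (A $ k $ k)"
proof -
  have "(\<chi> i. if i = k then 1 else 0) \<bullet> (A *v (\<chi> i. if i = k then 1 else 0)) = Re (A $ k $ k)"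
    unfolding matrix_vector_scale_axis
    by (simp add: inner_vec_def if_distrib[of "\<lambda>y. inner y _"] cong: if_cong)
  then show ?thesis using psdD[OF assms] by metis
qed

lemma hermitian_diag: "hermitian A \<Longrightarrow> A $ k $ k = complex_of_real (Re (A $ k $ k))"
  using hermitian_nth[of A k k] by (simp add: complex_eq_iff)

text \<open>Changing \<open>u\<close> in coordinate \<open>k\<close> alone exposes the form as a
  quadratic in \<open>a\<close>. Suitable choices of \<open>a\<close> yield the vanishing column at
  a zero diagonal entry and the Schur complement.\<close>

lemma quadratic_shift:
  assumes "hermitian A"
  shows "(u - (\<chi> i. if i = k then a else 0)) \<bullet> (A *v (u - (\<chi> i. if i = k then a else 0)))
    = u \<bullet> (A *v u) - 2 * Re (a * cnj (cdot (\<chi> i. A $ i $ k) u)) + (cmod a)\<^sup>2 * Re (A $ k $ k)"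
proof -
  let ?e = "(\<chi> i. if i = k then a else 0) :: complex^'a"
  have 1: "u \<bullet> (A *v ?e) = Re (a * cnj (cdot (\<chi> i. A $ i $ k) u))"
    unfolding matrix_vector_scale_axis
    by (simp add: inner_vec_def inner_complex_eq_Re cdot_def sum_distrib_left mult_ac
        del: times_complex.sel)
  have 2: "?e \<bullet> (A *v u) = u \<bullet> (A *v ?e)"
    using hermitian_inner[OF assms, of u ?e] by (simp add: inner_commute)
  have 3: "?e \<bullet> (A *v ?e) = (cmod a)\<^sup>2 * Re (A $ k $ k)"
    unfolding matrix_vector_scale_axis
    by (simp add: inner_vec_def if_distrib[of "\<lambda>y. inner y _"] cong: if_cong)
       (subst hermitian_diag[OF assms, of k],
        simp add: inner_complex_def cmod_power2, simp add: power2_eq_square algebra_simps)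
  show ?thesis
    using 1 2 3
    by (simp add: matrix_vector_mult_diff_distrib inner_diff_left inner_diff_right)
qed

text \<open>With a zero diagonal entry the quadratic term of the shift disappears, and the form, now
  affine in the real step \<open>N\<close>, stays nonnegative for all \<open>N\<close> only if the
  column is zero.\<close>

lemma psd_zero_diag:
  assumes "psd A" and "Re (A $ k $ k) = 0"
  shows "A $ i $ k = 0"
proof -
  have h: "hermitian A" using assms(1) by (simp add: psd_iff)
  define c where "c = (\<chi> i. A $ i $ k)"
  define q where "q = c \<bullet> (A *v c)"
  have cc: "cdot c c = complex_of_real ((norm c)\<^sup>2)"
    by (simp add: complex_eq_iff Re_cdot_eq_inner power2_norm_eq_inner)
       (simp add: cdot_def)
  have "(norm c)\<^sup>2 = 0"
  proof (rule ccontr)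
    assume n: "(norm c)\<^sup>2 \<noteq> 0"
    have "0 \<le> q - 2 * N * (norm c)\<^sup>2" for N
      using psdD[OF assms(1), of "c - (\<chi> i. if i = k then complex_of_real N else 0)"]
      unfolding quadratic_shift[OF h]
      by (simp add: assms(2) c_def[symmetric] cc q_def)
    \<comment> \<open>At this \<open>N\<close> the bound reads 0 \<le> -1.\<close>
    from this[of "(q + 1) / (2 * (norm c)\<^sup>2)"] n show False
      by simp
  qed
  then show ?thesis by (simp add: c_def vec_eq_iff)
qed

text \<open>The shift \<open>a = s / \<rho>\<close> minimises the form of \<open>A\<close> over
  changes of coordinate \<open>k\<close>, and the minimum is the form of the Schur
  complement.\<close>

lemma psd_schur:
  assumes "psd A" and "Re (A $ k $ k) > 0"
  defines "c \<equiv> \<chi> i. A $ i $ k"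
  shows "psd (A - (1 / Re (A $ k $ k)) *\<^sub>R outer c c)"
proof -
  define \<rho> where "\<rho> = Re (A $ k $ k)"
  have h: "hermitian A" using assms(1) by (simp add: psd_iff)
  have "0 \<le> u \<bullet> ((A - (1 / \<rho>) *\<^sub>R outer c c) *v u)" for u
  proof -
    define s where "s = cdot c u"
    have "0 \<le> u \<bullet> (A *v u) - 2 * Re (s / \<rho> * cnj s) + (cmod (s / \<rho>))\<^sup>2 * \<rho>"
      using psdD[OF assms(1), of "u - (\<chi> i. if i = k then s / \<rho> else 0)"]
      unfolding quadratic_shift[OF h]
      by (simp add: c_def[symmetric] s_def \<rho>_def)
    also have "Re (s / \<rho> * cnj s) = (cmod s)\<^sup>2 / \<rho>"
      unfolding cmod_power2 by (simp add: power2_eq_square add_divide_distrib)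
    also have "(cmod (s / \<rho>))\<^sup>2 * \<rho> = (cmod s)\<^sup>2 / \<rho>"
      using assms(2) by (simp add: norm_divide \<rho>_def field_simps power2_eq_square)
    finally show ?thesis
      by (simp add: matrix_vector_mult_diff_rdistrib inner_scaleR_matrix
          inner_diff_right quadratic_outer s_def)
  qed
  then show ?thesis
    unfolding psd_iff \<rho>_def using h by (simp add: hermitian_diff hermitian_scaleR hermitian_outer)
qed

text \<open>Successive Schur complements peel off rank-one terms of \<open>V\<close>, as in a Cholesky
  factorisation.\<close>

lemma psd_inner_nonneg:
  assumes "psd A" and "psd V"
  shows "0 \<le> A \<bullet> V"
proof -
  \<comment> \<open>\<open>S\<close> contains the support of \<open>V\<close>: rows and columns with
    index outside it vanish. Each peeling step removes one index, so the induction ends at the zero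
    matrix.\<close>
  have "0 \<le> A \<bullet> V" if "finite S" "psd V" "\<And>i j. i \<notin> S \<or> j \<notin> S \<Longrightarrow> V $ i $ j = 0" for S V
    using that
  proof (induction S arbitrary: V)
    case empty
    then have "V = 0" by (simp add: vec_eq_iff)
    then show ?case by simp
  next
    case (insert k S)
    have h: "hermitian V" using insert.prems by (simp add: psd_iff)
    define \<rho> where "\<rho> = Re (V $ k $ k)"
    define c where "c = (\<chi> i. V $ i $ k)"
    show ?case
    proof (cases "\<rho> = 0")
      case True
      then have "V $ i $ k = 0" for i using psd_zero_diag[OF insert.prems(1), of k i] by (simp add: \<rho>_def)
      moreover from this have "V $ k $ i = 0" for i using hermitian_nth[OF h, of i k] by simp
      ultimately show ?thesis
        using insert.prems by (intro insert.IH) (auto, metis+)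
    next
      case False
      then have pos: "\<rho> > 0" using psd_diag_nonneg[OF insert.prems(1), of k] by (simp add: \<rho>_def)
      have Vkk: "V $ k $ k = complex_of_real \<rho>"
        using hermitian_diag[OF h] \<rho>_def by simp
      let ?V = "V - (1 / \<rho>) *\<^sub>R outer c c"
      have e: "?V $ i $ j = V $ i $ j - V $ i $ k * V $ k $ j / \<rho>" for i j
        by (simp add: outer_def c_def hermitian_nth[OF h])
              (simp add: scaleR_conv_of_real)
      have "0 \<le> A \<bullet> ?V"
      proof (rule insert.IH)
        show "psd ?V"
          using psd_schur[OF insert.prems(1), of k] pos by (simp add: \<rho>_def c_def)
        \<comment> \<open>Row and column \<open>k\<close> cancel because
          \<open>V $ k $ k = \<rho>\<close>; at other indices outside \<open>S\<close> both terms
          already vanish.\<close>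
        show "?V $ i $ j = 0" if "i \<notin> S \<or> j \<notin> S" for i j
          unfolding e using that insert.prems(2)[of i j] insert.prems(2)[of i k]
            insert.prems(2)[of k j] pos Vkk
          by (cases "i = k"; cases "j = k") auto
      qed
      moreover have "0 \<le> A \<bullet> outer c c"
        using psdD[OF assms(1)] by (simp add: inner_outer)
      ultimately show ?thesis
        using pos by (simp add: inner_diff_right)
          (smt (verit, best) divide_nonneg_pos)
    qed
  qed
  from this[of UNIV V] assms(2) show ?thesis by simp
qed


section \<open>PSK symbols and the cone at a polygon vertex\<close>

text \<open>Closure under products and conjugation becomes algebra in this form, which permits the
  rotation by \<open>cnj (xs $ i)\<close>.\<close>

lemma psk_set_eq_roots_of_unity:
  assumes "M > 0"
  shows "psk_set M = {w. w ^ M = 1}"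
proof -
  have "psk_set M = (\<lambda>k. cis (2 * pi * real k / real M)) ` {..<M}"
  proof -
    have "{1..M} = Suc ` {..<M}"
      by (simp add: lessThan_atLeast0 image_Suc_atLeastLessThan atLeastLessThanSuc_atLeastAtMost)
    then show ?thesis
      by (simp add: psk_set_def psk_symbol_def image_image mult_ac)
  qed
  then show ?thesis
    using Complex.bij_betw_roots_unity[OF assms] by (simp add: bij_betw_def)
qed

lemma psk_set_mult:
  "M > 0 \<Longrightarrow> s \<in> psk_set M \<Longrightarrow> w \<in> psk_set M \<Longrightarrow> s * w \<in> psk_set M"
  by (simp add: psk_set_eq_roots_of_unity power_mult_distrib)

lemma psk_set_cnj: "M > 0 \<Longrightarrow> s \<in> psk_set M \<Longrightarrow> cnj s \<in> psk_set M"
  by (simp add: psk_set_eq_roots_of_unity flip: complex_cnj_power)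

lemma cmod_psk: "s \<in> psk_set M \<Longrightarrow> cmod s = 1"
  by (auto simp: psk_set_def psk_symbol_def)

lemma cis_step_in_psk_set:
  assumes "M > 0" and "\<sigma> = 1 \<or> \<sigma> = (-1::real)"
  shows "cis (\<sigma> * (2 * pi / real M)) \<in> psk_set M"
proof -
  have "cis (\<sigma> * (2 * pi / real M)) ^ M = cis (\<sigma> * (2 * pi))"
    unfolding Complex.DeMoivre using assms(1) by simp
  also have "\<dots> = 1"
    using assms(2) by (auto simp: complex_eq_iff)
  finally show ?thesis using assms(1) by (simp add: psk_set_eq_roots_of_unity)
qed

text \<open>For \<open>w = cis (2 * \<phi>)\<close> other than 1, the ratio of
  \<open>\<bar>Im w\<bar>\<close> to \<open>1 - Re w\<close> is
  \<open>\<bar>cot \<phi>\<bar>\<close>, and \<phi> lies in \<open>[a, pi - a]\<close>, where this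
  is at most \<open>cot a\<close>.\<close>

lemma psk_vertex_cone:
  assumes "M \<ge> 2" and "w \<in> psk_set M"
  shows "\<bar>Im w\<bar> \<le> cot (pi / real M) * (1 - Re w)"
proof -
  define a where "a = pi / real M"
  have a: "0 < a" "a < pi" using assms(1) by (auto simp: a_def field_simps)
  have sa: "sin a > 0" using a by (simp add: sin_gt_zero)
  obtain j where j: "1 \<le> j" "j \<le> M" and w: "w = psk_symbol M j"
    using assms(2) by (auto simp: psk_set_def)
  define \<phi> where "\<phi> = (real j - 1) * a"
  have w2: "w = cis (2 * \<phi>)" by (simp add: w psk_symbol_def \<phi>_def a_def mult_ac)
  have Re: "1 - Re w = 2 * (sin \<phi>)\<^sup>2" and Im: "Im w = 2 * sin \<phi> * cos \<phi>"
    by (simp_all add: w2 cos_double_sin sin_double)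
  show ?thesis
  proof (cases "j = 1")
    case True
    then show ?thesis by (simp add: w2 \<phi>_def)
  next
    case False
    have Ma: "real M * a = pi" using assms(1) by (simp add: a_def)
    have j1: "1 \<le> real j - 1" "real j - 1 \<le> real M - 1" using j False by auto
    have lo: "a \<le> \<phi>" using mult_right_mono[OF j1(1), of a] a by (simp add: \<phi>_def)
    have hi: "\<phi> \<le> pi - a"
      using mult_right_mono[OF j1(2), of a] a Ma by (simp add: \<phi>_def left_diff_distrib)
    \<comment> \<open>Expanded, the two sines bound \<open>cos \<phi> * sin a\<close> and its
      negative by \<open>cos a * sin \<phi>\<close>.\<close>
    have "0 \<le> sin (\<phi> - a)" and "0 \<le> sin (\<phi> + a)"
      using lo hi a by (auto intro!: sin_ge_zero)
    then have "\<bar>cos \<phi>\<bar> * sin a \<le> cos a * sin \<phi>"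
      by (auto simp: sin_diff sin_add abs_if mult_ac)
    moreover have s: "0 \<le> sin \<phi>" using lo hi a by (intro sin_ge_zero) auto
    ultimately have "2 * sin \<phi> * (\<bar>cos \<phi>\<bar> * sin a) \<le> 2 * sin \<phi> * (cos a * sin \<phi>)"
      by (intro mult_left_mono) auto
    then have "\<bar>Im w\<bar> * sin a \<le> cos a * (1 - Re w)"
      using s by (simp add: Re Im abs_mult power2_eq_square mult_ac)
    then show ?thesis
      using sa by (simp add: cot_def a_def[symmetric] field_simps)
  qed
qed

text \<open>With \<open>a = pi / M\<close> these are the neighbours of the vertex 1, where the bound
  of \<open>psk_vertex_cone\<close> holds with equality.\<close>

lemma Re_Im_psk_step:
  fixes \<sigma> a :: real
  assumes "\<sigma> = 1 \<or> \<sigma> = -1" and "sin a \<noteq> 0"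
  shows "1 - Re (cis (\<sigma> * (2 * a))) = 2 * (sin a)\<^sup>2"
    and "Im (cis (\<sigma> * (2 * a))) = \<sigma> * (cot a * (2 * (sin a)\<^sup>2))"
  using assms by (auto simp: cos_double_sin sin_double cot_def power2_eq_square)

section \<open>Excess of the objective over its value at \<open>xs\<close>\<close>

lemma inner_Diag: "Diag w \<bullet> V = (\<Sum>i\<in>UNIV. w $ i * Re (V $ i $ i))"
proof -
  have "Diag w $ i $ j \<bullet> V $ i $ j = (if i = j then w $ i * Re (V $ i $ i) else 0)" for i j
    by (simp add: Diag_def inner_complex_def)
  then show ?thesis by (simp add: inner_vec_def)
qed

text \<open>Completing the square: \<open>V = (X - x x\<^sup>\<dagger>) + (x - xs)(x - xs)\<^sup>\<dagger>\<close> absorbs all second-order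
  terms.\<close>

lemma esdr_objective_diff:
  fixes H :: "complex^'n^'m"
  defines "Q \<equiv> ctranspose H ** H"
  shows "esdr_objective H (H *v xs + v) x X - esdr_objective H (H *v xs + v) xs (outer_self xs)
    = Q \<bullet> (X - outer_self x + outer_self (x - xs)) - 2 * ((ctranspose H *v v) \<bullet> (x - xs))"
proof -
  define d where "d = x - xs"
  have X: "X - outer_self x + outer_self (x - xs)
      = X - outer_self xs - outer xs d - outer d xs"
    by (simp add: vec_eq_iff outer_self_def outer_def d_def algebra_simps)
  have "xs \<bullet> (Q *v d) = d \<bullet> (Q *v xs)"
    using hermitian_inner[of Q xs d] by (simp add: Q_def hermitian_gram inner_commute)
  moreover have "ctranspose H *v (H *v xs + v) = Q *v xs + ctranspose H *v v"
    by (simp add: Q_def matrix_vector_right_distrib matrix_vector_mul_assoc)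
  ultimately show ?thesis
    unfolding X
    by (simp add: esdr_objective_def Let_def mat_inner_eq_inner Re_cdot_eq_inner Q_def[symmetric]
        inner_diff_right inner_outer outer_self_eq_outer inner_add_left d_def inner_commute
        algebra_simps)
qed

text \<open>Multiplying coordinate \<open>i\<close> by \<open>cnj (xs $ i)\<close> moves its vertex
  to 1. By \<open>X $ i $ i = 1\<close> the diagonal of \<open>V\<close> measures
  \<open>1 - Re (y i)\<close>, so the \<open>Re z\<close> part of the linear term becomes a
  \<open>Diag\<close> pairing and only the \<open>Im z\<close> part remains.\<close>

lemma esdr_gap:
  fixes H :: "complex^'n^'m" and v :: "complex^'m" and xs x z :: "complex^'n" and X :: "complex^'n^'n"
  assumes xs: "\<And>i. cmod (xs $ i) = 1" and X: "\<And>i. X $ i $ i = 1"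
    and z: "\<And>i. (ctranspose H *v v) $ i = xs $ i * z $ i"
  defines "Q \<equiv> ctranspose H ** H"
    and "V \<equiv> X - outer_self x + outer_self (x - xs)"
    and "y \<equiv> \<lambda>i. cnj (xs $ i) * x $ i"
  shows "Re (V $ i $ i) = 2 * (1 - Re (y i))"
    and "esdr_objective H (H *v xs + v) x X - esdr_objective H (H *v xs + v) xs (outer_self xs)
      = (Q + Diag (vec_Re z)) \<bullet> V - 2 * (\<Sum>i\<in>UNIV. Im (z $ i) * Im (y i))"
proof -
  have u: "Re (xs $ i) * Re (xs $ i) + Im (xs $ i) * Im (xs $ i) = 1" for i
    using xs[of i] cmod_power2[of "xs $ i"] by (simp add: power2_eq_square)
  show V: "Re (V $ i $ i) = 2 * (1 - Re (y i))" for i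
    using u[of i] by (simp add: V_def outer_self_def X y_def algebra_simps)
  have "(ctranspose H *v v) $ i \<bullet> (x - xs) $ i
      = Im (z $ i) * Im (y i) - Re (z $ i) * (1 - Re (y i))" for i
  proof -
    have "(ctranspose H *v v) $ i \<bullet> (x - xs) $ i
        = Re (cnj (z $ i) * (y i - cnj (xs $ i) * xs $ i))"
      by (simp add: z inner_complex_eq_Re y_def algebra_simps)
    also have "cnj (xs $ i) * xs $ i = 1"
      using u[of i] by (simp add: complex_eq_iff)
    finally show ?thesis by (simp add: algebra_simps)
  qed
  then have "(ctranspose H *v v) \<bullet> (x - xs)
      = (\<Sum>i\<in>UNIV. Im (z $ i) * Im (y i)) - (\<Sum>i\<in>UNIV. Re (z $ i) * (1 - Re (y i)))"
    by (simp add: inner_vec_def sum_subtractf)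
  moreover have "Diag (vec_Re z) \<bullet> V = 2 * (\<Sum>i\<in>UNIV. Re (z $ i) * (1 - Re (y i)))"
    unfolding inner_Diag V by (simp add: vec_Re_def sum_distrib_left algebra_simps)
  ultimately show "esdr_objective H (H *v xs + v) x X
      - esdr_objective H (H *v xs + v) xs (outer_self xs)
      = (Q + Diag (vec_Re z)) \<bullet> V - 2 * (\<Sum>i\<in>UNIV. Im (z $ i) * Im (y i))"
    unfolding esdr_objective_diff Q_def[symmetric] V_def[symmetric]
    by (simp add: inner_add_left)
qed

section \<open>Feasible points near a vertex\<close>

text \<open>Each rotated symbol satisfies the cone bound, which passes to convex combinations
  because its left side is convex and its right side affine.\<close>

lemma esdr_feasible_cone:
  assumes M: "M \<ge> 2" and xs: "xs $ i \<in> psk_set M" and f: "esdr_feasible M t x X"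
  shows "\<bar>Im (cnj (xs $ i) * x $ i)\<bar> \<le> cot (pi / real M) * (1 - Re (cnj (xs $ i) * x $ i))"
proof -
  define w where "w j = cnj (xs $ i) * psk_symbol M j" for j
  have t: "(\<Sum>j=1..M. t i j) = 1" "\<And>j. j \<in> {1..M} \<Longrightarrow> 0 \<le> t i j"
    and x: "x $ i = (\<Sum>j=1..M. complex_of_real (t i j) * psk_symbol M j)"
    using f by (auto simp: esdr_feasible_def)
  have y: "cnj (xs $ i) * x $ i = (\<Sum>j=1..M. complex_of_real (t i j) * w j)"
    by (simp add: x w_def sum_distrib_left mult_ac)
  have w: "w j \<in> psk_set M" if "j \<in> {1..M}" for j
    unfolding w_def using M xs that
    by (intro psk_set_mult psk_set_cnj) (auto simp: psk_set_def)
  have "\<bar>Im (cnj (xs $ i) * x $ i)\<bar> \<le> (\<Sum>j=1..M. t i j * \<bar>Im (w j)\<bar>)"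
    unfolding y using t(2) by (auto simp: abs_mult intro!: order_trans[OF sum_abs] sum_mono)
  also have "\<dots> \<le> (\<Sum>j=1..M. t i j * (cot (pi / real M) * (1 - Re (w j))))"
    using t(2) psk_vertex_cone[OF M w] by (intro sum_mono mult_left_mono) auto
  also have "\<dots> = cot (pi / real M) * ((\<Sum>j=1..M. t i j) - (\<Sum>j=1..M. t i j * Re (w j)))"
    by (simp add: sum_distrib_left sum_subtractf[symmetric] algebra_simps)
  finally show ?thesis unfolding y t(1) by simp
qed

lemma esdr_feasible_vertex:
  fixes xs :: "complex^'n"
  assumes xs: "\<And>i. xs $ i \<in> psk_set M"
  shows "\<exists>t. esdr_feasible M t xs (outer_self xs)"
proof -
  have "\<forall>i. \<exists>j. j \<in> {1..M} \<and> psk_symbol M j = xs $ i"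
    using xs unfolding psk_set_def by (metis imageE)
  then obtain J where J: "\<And>i. J i \<in> {1..M}" "\<And>i. psk_symbol M (J i) = xs $ i" by metis
  have "xs $ i * cnj (xs $ i) = 1" for i
    using cmod_psk[OF xs] by (simp add: complex_norm_square[symmetric])
  moreover have "psd (outer_self xs - outer_self xs)"
    by (simp add: psd_iff hermitian_def ctranspose_def vec_eq_iff)
  ultimately have "esdr_feasible M (\<lambda>i j. if j = J i then 1 else 0) xs (outer_self xs)"
    using J
    by (simp add: esdr_feasible_def loewner_ge_def outer_self_eq_outer hermitian_outer
        if_distrib[of "\<lambda>y. y * _"] if_distrib[of complex_of_real] cong: if_cong)
       (simp add: outer_def)
  then show ?thesis by blast
qed

text \<open>Moving each coordinate from its vertex along the polygon edge on the side of \<open>Im z\<close>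
  makes the cone inequality tight. The step length is dictated by \<open>X\<^sub>i\<^sub>i = 1\<close>, and the second-order
  term \<open>(x - xs)(x - xs)\<^sup>\<dagger>\<close> is dominated by \<open>\<epsilon> P\<close> for small \<open>\<epsilon>\<close> because \<open>P\<close> is positive
  definite.\<close>

lemma esdr_feasible_direction:
  fixes xs z :: "complex^'n" and P :: "complex^'n^'n"
  assumes M: "M \<ge> 2" and xs: "\<And>i. xs $ i \<in> psk_set M"
    and P: "hermitian P" "\<beta> > 0" "\<And>u. \<beta> * (norm u)\<^sup>2 \<le> u \<bullet> (P *v u)"
  obtains \<epsilon> t x X where "\<epsilon> > 0" and "esdr_feasible M t x X"
    and "X - outer_self x + outer_self (x - xs) = \<epsilon> *\<^sub>R P"
    and "\<And>i. Im (z $ i) * Im (cnj (xs $ i) * x $ i)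
      = cot (pi / real M) * \<bar>Im (z $ i)\<bar> * (1 - Re (cnj (xs $ i) * x $ i))"
proof -
  define a where "a = pi / real M"
  have a: "0 < a" "a < pi" using M by (auto simp: a_def field_simps)
  then have sa: "sin a > 0" by (simp add: sin_gt_zero)
  define \<sigma> :: "'n \<Rightarrow> real" where "\<sigma> i = (if Im (z $ i) \<ge> 0 then 1 else -1)" for i
  define \<kappa> where "\<kappa> i = cis (\<sigma> i * (2 * a))" for i
  have \<sigma>: "\<sigma> i = 1 \<or> \<sigma> i = -1" for i by (simp add: \<sigma>_def)
  have Re_\<kappa>: "1 - Re (\<kappa> i) = 2 * (sin a)\<^sup>2"
    and Im_\<kappa>: "Im (\<kappa> i) = \<sigma> i * (cot a * (2 * (sin a)\<^sup>2))" for i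
    unfolding \<kappa>_def using Re_Im_psk_step[OF \<sigma>, of a i] sa by auto
  have \<kappa>: "xs $ i * \<kappa> i \<in> psk_set M" for i
    using M xs cis_step_in_psk_set[OF _ \<sigma>, of M i]
    by (intro psk_set_mult) (auto simp: \<kappa>_def a_def)
  have u: "cnj (xs $ i) * xs $ i = 1" for i
    using cmod_psk[OF xs] by (simp add: complex_norm_square[symmetric] mult.commute)
  \<comment> \<open>Solves the diagonal condition
    \<open>2 * (1 - Re y) = \<epsilon> * Re (P $ i $ i)\<close>, where \<open>1 - Re y\<close> is
    \<open>\<epsilon> * g i * (2 * (sin a)\<^sup>2)\<close>.\<close>
  define g where "g i = Re (P $ i $ i) / (4 * (sin a)\<^sup>2)" for i
  have psdP: "psd P"
    unfolding psd_iff using P order_trans[OF _ P(3)] by simp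
  have g0: "g i \<ge> 0" for i
    using psd_diag_nonneg[OF psdP] by (simp add: g_def)
  define e where "e = (\<chi> i. xs $ i * (complex_of_real (g i) * (\<kappa> i - 1)))"
  \<comment> \<open>One denominator for two demands: \<open>\<epsilon> * g i \<le> 1\<close> keeps
    the edge weights in \<open>[0, 1]\<close>, and
    \<open>\<epsilon> * (norm e)\<^sup>2 \<le> \<beta>\<close> lets
    \<open>\<epsilon> *\<^sub>R P\<close> dominate the second-order term. The summand 1 keeps
    \<open>D\<close> positive.\<close>
  define D where "D = 1 + (\<Sum>i\<in>UNIV. g i) + (norm e)\<^sup>2 / \<beta>"
  define \<epsilon> where "\<epsilon> = 1 / D"
  have sg: "g i \<le> (\<Sum>i\<in>UNIV. g i)" for i using g0 by (intro member_le_sum) auto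
  have D: "D \<ge> 1" using P(2) by (simp add: D_def sum_nonneg g0)
  have e0: "\<epsilon> > 0" using D by (simp add: \<epsilon>_def)
  have "g i \<le> D" for i using sg[of i] divide_nonneg_pos[OF zero_le_power2 P(2), of "norm e"] by (simp add: D_def)
  then have e1: "\<epsilon> * g i \<le> 1" for i using D by (simp add: \<epsilon>_def field_simps)
  have "(norm e)\<^sup>2 / \<beta> \<le> D" by (simp add: D_def sum_nonneg g0)
  then have e2: "\<epsilon> * (norm e)\<^sup>2 \<le> \<beta>" using D P(2) by (simp add: \<epsilon>_def field_simps)
  define x where "x = xs + \<epsilon> *\<^sub>R e"
  \<comment> \<open>The expansion of \<open>outer_self x\<close> with its second-order part replaced
    by \<open>\<epsilon> *\<^sub>R P\<close>.\<close>
  define X where "X = outer_self xs + (outer xs (\<epsilon> *\<^sub>R e) + outer (\<epsilon> *\<^sub>R e) xs) + \<epsilon> *\<^sub>R P"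
  have V: "X - outer_self x + outer_self (x - xs) = \<epsilon> *\<^sub>R P"
    by (simp add: X_def x_def vec_eq_iff outer_self_def outer_def algebra_simps)
  have x: "x $ i = complex_of_real (1 - \<epsilon> * g i) * xs $ i
      + complex_of_real (\<epsilon> * g i) * (xs $ i * \<kappa> i)" for i
    by (simp add: x_def e_def) (simp add: scaleR_conv_of_real algebra_simps)
  have y: "cnj (xs $ i) * x $ i = 1 + complex_of_real (\<epsilon> * g i) * (\<kappa> i - 1)" for i
  proof -
    have "cnj (xs $ i) * x $ i
        = (cnj (xs $ i) * xs $ i) * (1 + complex_of_real (\<epsilon> * g i) * (\<kappa> i - 1))"
      by (simp add: x algebra_simps)
    then show ?thesis by (simp add: u)
  qed
  have Re_y: "1 - Re (cnj (xs $ i) * x $ i) = \<epsilon> * g i * (2 * (sin a)\<^sup>2)" for i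
    unfolding y Re_\<kappa>[of i, symmetric] by (simp add: algebra_simps)
  have Im_y: "Im (cnj (xs $ i) * x $ i) = \<epsilon> * g i * (\<sigma> i * (cot a * (2 * (sin a)\<^sup>2)))" for i
    unfolding y Im_\<kappa>[symmetric] by simp
  have hX: "hermitian X"
    unfolding X_def outer_self_eq_outer
    by (intro hermitian_add hermitian_outer hermitian_outer_cross hermitian_scaleR P(1))
  have diag: "X $ i $ i = 1" for i
  proof -
    have "Re (X $ i $ i) = 1"
    proof -
      define q where "q = cnj (xs $ i) * x $ i"
      have "X $ i $ i = cnj (xs $ i) * xs $ i + (q - cnj (xs $ i) * xs $ i)
          + cnj (q - cnj (xs $ i) * xs $ i) + \<epsilon> *\<^sub>R P $ i $ i"
        by (simp add: X_def x_def q_def outer_self_def outer_def algebra_simps)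
      then have "Re (X $ i $ i) = 1 - 2 * (1 - Re q) + \<epsilon> * Re (P $ i $ i)"
        unfolding u by simp
      then have "Re (X $ i $ i)
          = 1 - 2 * (1 - Re (cnj (xs $ i) * x $ i)) + \<epsilon> * Re (P $ i $ i)"
        unfolding q_def .
      then show ?thesis using sa unfolding Re_y by (simp add: g_def)
    qed
    then show ?thesis using hermitian_diag[OF hX, of i] by simp
  qed
  have "psd (X - outer_self x)"
  proof -
    have eq: "X - outer_self x = \<epsilon> *\<^sub>R P - (\<epsilon> * \<epsilon>) *\<^sub>R outer e e"
      using V by (simp add: x_def vec_eq_iff outer_self_def outer_def algebra_simps)
    have "0 \<le> w \<bullet> ((\<epsilon> *\<^sub>R P - (\<epsilon> * \<epsilon>) *\<^sub>R outer e e) *v w)" for w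
    proof -
      have "\<epsilon> * (cmod (cdot e w))\<^sup>2 \<le> \<epsilon> * (norm e * norm w)\<^sup>2"
        using e0 cmod_cdot_le[of e w] by (intro mult_left_mono power_mono) auto
      also have "\<dots> = (\<epsilon> * (norm e)\<^sup>2) * (norm w)\<^sup>2" by (simp add: power_mult_distrib)
      also have "\<dots> \<le> \<beta> * (norm w)\<^sup>2" using e2 by (intro mult_right_mono) auto
      also have "\<dots> \<le> w \<bullet> (P *v w)" by (rule P(3))
      finally have "0 \<le> \<epsilon> * (w \<bullet> (P *v w) - \<epsilon> * (cmod (cdot e w))\<^sup>2)"
        using e0 by simp
      then show ?thesis
        by (simp add: matrix_vector_mult_diff_rdistrib inner_diff_right inner_scaleR_matrix
            quadratic_outer algebra_simps)
    qed
    then show ?thesis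
      unfolding psd_iff eq
      by (simp add: hermitian_diff hermitian_scaleR hermitian_outer P(1))
  qed
  have "\<forall>i. \<exists>j. j \<in> {1..M} \<and> psk_symbol M j = xs $ i"
    using xs unfolding psk_set_def by (metis imageE)
  then obtain J where J: "\<And>i. J i \<in> {1..M}" "\<And>i. psk_symbol M (J i) = xs $ i" by metis
  have "\<forall>i. \<exists>j. j \<in> {1..M} \<and> psk_symbol M j = xs $ i * \<kappa> i"
    using \<kappa> unfolding psk_set_def by (metis imageE)
  then obtain K where K: "\<And>i. K i \<in> {1..M}" "\<And>i. psk_symbol M (K i) = xs $ i * \<kappa> i" by metis
  \<comment> \<open>Weight \<open>\<epsilon> * g i\<close> sits on the neighbour and the rest on the
    vertex; adding indicators lets the sums split without comparing \<open>J i\<close> with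
    \<open>K i\<close>.\<close>
  define t where "t i j = (if j = J i then 1 - \<epsilon> * g i else 0) + (if j = K i then \<epsilon> * g i else 0)"
    for i j
  have t0: "0 \<le> t i j" for i j using e0 e1[of i] g0[of i] by (simp add: t_def)
  have t1: "(\<Sum>j=1..M. t i j) = 1" for i
    using J(1)[of i] K(1)[of i] by (simp add: t_def sum.distrib)
  have "complex_of_real (t i j) * psk_symbol M j
      = (if j = J i then complex_of_real (1 - \<epsilon> * g i) * psk_symbol M j else 0)
      + (if j = K i then complex_of_real (\<epsilon> * g i) * psk_symbol M j else 0)" for i j
    by (simp add: t_def algebra_simps)
  then have tx: "x $ i = (\<Sum>j=1..M. complex_of_real (t i j) * psk_symbol M j)" for i
    using J[of i] K[of i] by (simp add: sum.distrib x)
  have feas: "esdr_feasible M t x X"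
    unfolding esdr_feasible_def loewner_ge_def
    using hX diag tx t1 t0 \<open>psd (X - outer_self x)\<close> by blast
  have "Im (z $ i) * Im (cnj (xs $ i) * x $ i)
      = cot a * \<bar>Im (z $ i)\<bar> * (1 - Re (cnj (xs $ i) * x $ i))" for i
    unfolding Re_y Im_y by (simp add: \<sigma>_def)
  then show thesis
    using that[OF e0 feas V] by (simp add: a_def)
qed

section \<open>Equivalence of tightness and the semidefinite criterion\<close>

theorem theorem3p2:
  fixes M b :: nat
    and H :: "complex^'n^'m"
    and v r :: "complex^'m"
    and xs z :: "complex^'n"
    and Q :: "complex^'n^'n"
  assumes "M = 2 ^ b" and "M \<ge> 4"
    and "\<And>i. xs $ i \<in> psk_set M"
    and "r = H *v xs + v"
    and "Q = ctranspose H ** H"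
    and "\<And>i. z $ i = inverse (xs $ i) * (ctranspose H *v v) $ i"
  shows "esdr_tight M H r xs \<longleftrightarrow>
    Q + Diag (vec_Re z) - cot (pi / real M) *\<^sub>R Diag (vec_abs (vec_Im z)) \<succeq> 0"
proof -
  define A where "A = Q + Diag (vec_Re z) - cot (pi / real M) *\<^sub>R Diag (vec_abs (vec_Im z))"
  define y where "y x i = cnj (xs $ i) * x $ i" for x i
  define V where "V x X = X - outer_self x + outer_self (x - xs)" for x X
  have M: "M \<ge> 2" using assms(2) by simp
  have cm: "cmod (xs $ i) = 1" for i using cmod_psk[OF assms(3)] .
  have zz: "(ctranspose H *v v) $ i = xs $ i * z $ i" for i
  proof -
    have "xs $ i \<noteq> 0" using cm[of i] by auto
    then show ?thesis by (simp add: assms(6))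
  qed
  \<comment> \<open>The cotangent term is absorbed into \<open>A\<close> through the diagonal of
    \<open>V\<close>. What remains is the slack of the cone bound, nonnegative at feasible points
    and zero along the chosen edges.\<close>
  have gap: "esdr_objective H r x X - esdr_objective H r xs (outer_self xs)
      = A \<bullet> V x X + 2 * (\<Sum>i\<in>UNIV.
          cot (pi / real M) * \<bar>Im (z $ i)\<bar> * (1 - Re (y x i)) - Im (z $ i) * Im (y x i))"
    if "esdr_feasible M t x X" for t x X
  proof -
    have X: "X $ i $ i = 1" for i using that by (simp add: esdr_feasible_def)
    have "Diag (vec_abs (vec_Im z)) \<bullet> V x X
        = 2 * (\<Sum>i\<in>UNIV. \<bar>Im (z $ i)\<bar> * (1 - Re (y x i)))"
      unfolding inner_Diag V_def esdr_gap(1)[OF cm X zz] y_def[symmetric]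
      by (simp add: vec_abs_def vec_Im_def sum_distrib_left algebra_simps)
    then show ?thesis
      using esdr_gap(2)[OF cm X zz, where x = x] unfolding y_def[symmetric] V_def[symmetric]
      by (simp add: assms(4) A_def inner_diff_left assms(5)[symmetric]
          sum_subtractf sum_distrib_left mult_ac)
  qed
  have hA: "hermitian A"
    unfolding A_def assms(5)
    by (intro hermitian_diff hermitian_add hermitian_gram hermitian_Diag hermitian_scaleR)
  have "esdr_tight M H r xs \<longleftrightarrow> psd A"
  proof
    assume "psd A"
    obtain t where t: "esdr_feasible M t xs (outer_self xs)"
      using esdr_feasible_vertex[OF assms(3)] by blast
    have "esdr_objective H r xs (outer_self xs) \<le> esdr_objective H r x X"
      if f: "esdr_feasible M t' x X" for t' x X
    proof -
      have "psd (V x X)"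
        unfolding V_def using f
        by (intro psd_add) (simp_all add: esdr_feasible_def loewner_ge_def outer_self_eq_outer psd_outer)
      then have "0 \<le> A \<bullet> V x X" using psd_inner_nonneg \<open>psd A\<close> by blast
      moreover have "Im (z $ i) * Im (y x i)
          \<le> cot (pi / real M) * \<bar>Im (z $ i)\<bar> * (1 - Re (y x i))" for i
      proof -
        have "Im (z $ i) * Im (y x i) \<le> \<bar>Im (z $ i)\<bar> * \<bar>Im (y x i)\<bar>"
          by (metis abs_ge_self abs_mult)
        also have "\<dots> \<le> \<bar>Im (z $ i)\<bar> * (cot (pi / real M) * (1 - Re (y x i)))"
          using esdr_feasible_cone[OF M assms(3) f] unfolding y_def
          by (intro mult_left_mono) auto
        finally show ?thesis by (simp add: mult_ac)
      qed
      ultimately show ?thesis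
        using gap[OF f] by (smt (verit) sum_nonneg)
    qed
    with t show "esdr_tight M H r xs"
      unfolding esdr_tight_def esdr_optimal_def by blast
  next
    assume tight: "esdr_tight M H r xs"
    have "0 \<le> u \<bullet> (A *v u)" for u
    proof (rule ccontr)
      assume "\<not> 0 \<le> u \<bullet> (A *v u)"
      then have neg: "u \<bullet> (A *v u) < 0" by simp
      \<comment> \<open>Adding \<open>\<beta> *\<^sub>R mat 1\<close> to \<open>outer u u\<close>
        raises the pairing with \<open>A\<close> by at most \<open>\<beta> * \<tau>\<close>.
        Dividing by \<open>\<tau> + 1\<close> keeps this below
        \<open>- (u \<bullet> (A *v u))\<close>, so \<open>A \<bullet> P\<close> stays negative
        while \<open>P\<close> becomes positive definite.\<close>
      define \<tau> where "\<tau> = \<bar>A \<bullet> mat 1\<bar>"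
      define \<beta> where "\<beta> = - (u \<bullet> (A *v u)) / (\<tau> + 1)"
      define P where "P = outer u u + \<beta> *\<^sub>R mat 1"
      have \<tau>: "0 \<le> \<tau>" by (simp add: \<tau>_def)
      have \<beta>: "\<beta> > 0" using neg \<tau> by (simp add: \<beta>_def field_simps)
      have "\<beta> * (A \<bullet> mat 1) \<le> \<beta> * \<tau>" using \<beta> by (simp add: \<tau>_def)
      also have "\<beta> * \<tau> < - (u \<bullet> (A *v u))"
        using neg \<tau> by (simp add: \<beta>_def field_simps)
      finally have AP: "A \<bullet> P < 0"
        by (simp add: P_def inner_add_right inner_outer)
      have hP: "hermitian P"
        unfolding P_def by (intro hermitian_add hermitian_outer hermitian_scaleR hermitian_mat)
      have pP: "\<beta> * (norm w)\<^sup>2 \<le> w \<bullet> (P *v w)" for w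
        by (simp add: P_def matrix_vector_mult_add_rdistrib inner_add_right quadratic_outer
            inner_scaleR_matrix power2_norm_eq_inner)
      obtain \<epsilon> t x X where \<epsilon>: "\<epsilon> > 0" and f: "esdr_feasible M t x X"
        and VP: "X - outer_self x + outer_self (x - xs) = \<epsilon> *\<^sub>R P"
        and edge: "\<And>i. Im (z $ i) * Im (cnj (xs $ i) * x $ i)
          = cot (pi / real M) * \<bar>Im (z $ i)\<bar> * (1 - Re (cnj (xs $ i) * x $ i))"
        using esdr_feasible_direction[OF M assms(3) hP \<beta> pP, of z] by blast
      have "esdr_objective H r x X - esdr_objective H r xs (outer_self xs) = \<epsilon> * (A \<bullet> P)"
        unfolding gap[OF f] V_def VP y_def edge by simp
      also have "\<dots> < 0" using \<epsilon> AP by (simp add: mult_pos_neg)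
      finally show False
        using tight f unfolding esdr_tight_def esdr_optimal_def by force
    qed
    then show "psd A" using hA by (simp add: psd_iff)
  qed
  then show ?thesis by (simp add: loewner_ge_def A_def)
qed

end
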